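(* Let $G$ be an innately transitive permutation group on a finite set $\Omega$ with plinth $M$, and fix $\omega\in\Omega$. Then the map $\mathcal E\mapsto\mathcal K_\omega(\mathcal E)$ is a bijection from $\mathrm{CD}(G)$ to the set of Cartesian systems of subgroups of $M$ with respect to $\omega$ that are invariant under conjugation by $G_\omega$.
   Context: A permutation group is innately transitive if it has a transitive minimal normal subgroup, called a plinth. A Cartesian decomposition of $\Omega$ is a set $\mathcal E=\{\Gamma_1,\dots,\Gamma_\ell\}$, $\ell\ge2$, of partitions of $\Omega$ with $|\gamma_1\cap\cdots\cap\gamma_\ell|=1$ for all $\gamma_i\in\Gamma_i$; $\mathrm{CD}(G)$ is the set of $G$-invariant Cartesian decompositions of $\Omega$. (Every $\mathcal E\in\mathrm{CD}(G)$ has each partition fixed by $M$.) For such $\mathcal E$, $\mathcal K_\omega(\mathcal E)=\{M_{\gamma_1},\dots,M_{\gamma_\ell}\}$, where $\gamma_i$ is the block of $\Gamma_i$ containing $\omega$ and $M_{\gamma_i}$ its setwise stabiliser. A set $\{K_1,\dots,K_\ell\}$ ($\ell\ge2$) of subgroups of $M$ is a Cartesian system of subgroups of $M$ with respect to $\omega$ if $\bigcap_iK_i=M_\omega$ and $K_i(\bigcap_{j\ne i}K_j)=M$ for all $i$. *)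

theory Defs
  imports "HOL-Algebra.Algebra" "HOL-Library.Disjoint_Sets"
begin

text \<open>Permutation groups on Omega are subgroups G of the symmetric group
  BijGroup Omega (bijections of Omega, extensional outside Omega).
  The group structure on G is the restriction of BijGroup Omega to G.\<close>

definition perm_group :: "'a set \<Rightarrow> ('a \<Rightarrow> 'a) set \<Rightarrow> bool" where
  "perm_group \<Omega> G \<longleftrightarrow> subgroup G (BijGroup \<Omega>)"

definition transitive_on :: "'a set \<Rightarrow> ('a \<Rightarrow> 'a) set \<Rightarrow> bool" where
  "transitive_on \<Omega> H \<longleftrightarrow> \<Omega> \<noteq> {} \<and> (\<forall>\<alpha>\<in>\<Omega>. \<forall>\<beta>\<in>\<Omega>. \<exists>h\<in>H. h \<alpha> = \<beta>)"

definition minimal_normal :: "'a set \<Rightarrow> ('a \<Rightarrow> 'a) set \<Rightarrow> ('a \<Rightarrow> 'a) set \<Rightarrow> bool" where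
  "minimal_normal \<Omega> G M \<longleftrightarrow>
     M \<lhd> (BijGroup \<Omega>)\<lparr>carrier := G\<rparr> \<and> M \<noteq> {\<one>\<^bsub>BijGroup \<Omega>\<^esub>} \<and>
     (\<forall>N. N \<lhd> (BijGroup \<Omega>)\<lparr>carrier := G\<rparr> \<longrightarrow> N \<subseteq> M \<longrightarrow>
          N = {\<one>\<^bsub>BijGroup \<Omega>\<^esub>} \<or> N = M)"

definition plinth :: "'a set \<Rightarrow> ('a \<Rightarrow> 'a) set \<Rightarrow> ('a \<Rightarrow> 'a) set \<Rightarrow> bool" where
  "plinth \<Omega> G M \<longleftrightarrow> minimal_normal \<Omega> G M \<and> transitive_on \<Omega> M"

definition innately_transitive :: "'a set \<Rightarrow> ('a \<Rightarrow> 'a) set \<Rightarrow> bool" where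
  "innately_transitive \<Omega> G \<longleftrightarrow> perm_group \<Omega> G \<and> (\<exists>M. plinth \<Omega> G M)"

definition stab :: "('a \<Rightarrow> 'a) set \<Rightarrow> 'a \<Rightarrow> ('a \<Rightarrow> 'a) set" where
  "stab H \<omega> = {h \<in> H. h \<omega> = \<omega>}"

definition set_stab :: "('a \<Rightarrow> 'a) set \<Rightarrow> 'a set \<Rightarrow> ('a \<Rightarrow> 'a) set" where
  "set_stab H \<gamma> = {h \<in> H. h ` \<gamma> = \<gamma>}"

definition cartesian_decomposition :: "'a set \<Rightarrow> 'a set set set \<Rightarrow> bool" where
  "cartesian_decomposition \<Omega> E \<longleftrightarrow>
     finite E \<and> card E \<ge> 2 \<and> (\<forall>\<Gamma>\<in>E. partition_on \<Omega> \<Gamma>) \<and>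
     (\<forall>f. (\<forall>\<Gamma>\<in>E. f \<Gamma> \<in> \<Gamma>) \<longrightarrow> card (\<Inter>\<Gamma>\<in>E. f \<Gamma>) = 1)"

definition G_invariant_CD :: "('a \<Rightarrow> 'a) set \<Rightarrow> 'a set set set \<Rightarrow> bool" where
  "G_invariant_CD G E \<longleftrightarrow> (\<forall>g\<in>G. \<forall>\<Gamma>\<in>E. (\<lambda>\<gamma>. g ` \<gamma>) ` \<Gamma> \<in> E)"

definition CD :: "'a set \<Rightarrow> ('a \<Rightarrow> 'a) set \<Rightarrow> 'a set set set set" where
  "CD \<Omega> G = {E. cartesian_decomposition \<Omega> E \<and> G_invariant_CD G E}"

definition K_omega :: "('a \<Rightarrow> 'a) set \<Rightarrow> 'a \<Rightarrow> 'a set set set \<Rightarrow> ('a \<Rightarrow> 'a) set set" where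
  "K_omega M \<omega> E = {set_stab M \<gamma> | \<gamma>. \<exists>\<Gamma>\<in>E. \<gamma> \<in> \<Gamma> \<and> \<omega> \<in> \<gamma>}"

definition cartesian_system ::
    "'a set \<Rightarrow> ('a \<Rightarrow> 'a) set \<Rightarrow> 'a \<Rightarrow> ('a \<Rightarrow> 'a) set set \<Rightarrow> bool" where
  "cartesian_system \<Omega> M \<omega> \<K> \<longleftrightarrow>
     finite \<K> \<and> card \<K> \<ge> 2 \<and>
     (\<forall>K\<in>\<K>. subgroup K (BijGroup \<Omega>) \<and> K \<subseteq> M) \<and>
     \<Inter>\<K> = stab M \<omega> \<and>
     (\<forall>K\<in>\<K>. K <#>\<^bsub>BijGroup \<Omega>\<^esub> (\<Inter>(\<K> - {K})) = M)"

definition conj_invariant ::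
    "'a set \<Rightarrow> ('a \<Rightarrow> 'a) set \<Rightarrow> ('a \<Rightarrow> 'a) set set \<Rightarrow> bool" where
  "conj_invariant \<Omega> H \<K> \<longleftrightarrow>
     (\<forall>g\<in>H. \<forall>K\<in>\<K>.
        (\<lambda>k. g \<otimes>\<^bsub>BijGroup \<Omega>\<^esub> k \<otimes>\<^bsub>BijGroup \<Omega>\<^esub> inv\<^bsub>BijGroup \<Omega>\<^esub> g) ` K \<in> \<K>)"

end

theory Submission
  imports Defs "HOL-Combinatorics.Permutations"
begin

text \<open>
  The point of the proof is that the plinth \<open>M\<close> fixes every partition of a \<open>G\<close>-invariant Cartesian
  decomposition. Let \<open>S\<close> consist of the partitions with a given number \<open>n \<ge> 2\<close> of parts. By minimality
  \<open>M\<close> acts on \<open>S\<close> trivially or faithfully. In the second case \<open>|M|\<close> divides \<open>|S|!\<close>; but \<open>n\<^sup>|\<^sup>S\<^sup>|\<close> divides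
  \<open>|\<Omega>|\<close>, which divides \<open>|M|\<close> by transitivity, and \<open>n\<^sup>k\<close> never divides \<open>k!\<close> for \<open>k \<ge> 1\<close>. Once the partitions are
  fixed, each is the block system of the stabiliser \<open>K\<close> of its part through \<open>\<omega>\<close>, so the inverse map
  sends a Cartesian system to the block systems with blocks \<open>m K \<omega>\<close>; the factorisations of \<open>M\<close>
  say exactly that cosets of the different \<open>K\<close> always meet.
\<close>

section \<open>Prime powers in factorials\<close>

text \<open>Legendre's formula in recursive form. Passing to \<open>Suc n\<close> changes neither
  side unless \<open>p\<close> divides \<open>Suc n\<close>; then the quotient grows by one too, and
  the factor \<open>p\<close> accounts for the extra 1.\<close>

lemma multiplicity_fact_div:
  fixes p n :: nat
  assumes p: "Factorial_Ring.prime p"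
  shows "multiplicity p (fact n) = n div p + multiplicity p (fact (n div p))"
proof (induction n)
  case 0
  show ?case by simp
next
  case (Suc n)
  have mult: "multiplicity p (fact (Suc k) :: nat) = multiplicity p (Suc k) + multiplicity p (fact k :: nat)" for k
    using p by (simp add: prime_elem_multiplicity_mult_distrib del: mult_Suc of_nat_Suc)
  show ?case
  proof (cases "p dvd Suc n")
    case True
    then have q: "Suc n div p = Suc (n div p)"
      by (simp add: div_Suc mod_eq_0_iff_dvd)
    have "multiplicity p (p * Suc (n div p)) = Suc (multiplicity p (Suc (n div p)))"
      using p by (intro multiplicity_times_same) auto
    moreover have "p * Suc (n div p) = Suc n"
      using True q by (metis dvd_mult_div_cancel)
    ultimately show ?thesis
      unfolding mult q Suc.IH by simp
  next
    case False
    then have "Suc n div p = n div p"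
      by (simp add: div_Suc mod_eq_0_iff_dvd)
    with False show ?thesis
      unfolding mult Suc.IH by (simp add: not_dvd_imp_multiplicity_0)
  qed
qed

text \<open>If \<open>q = n div p\<close> is nonzero, the recursion and the induction hypothesis
  give a value below \<open>q + q\<close>, and twice \<open>q\<close> is at most \<open>n\<close>
  because \<open>p\<close> is at least 2.\<close>

lemma multiplicity_fact_less:
  fixes p n :: nat
  assumes p: "Factorial_Ring.prime p" and "n > 0"
  shows "multiplicity p (fact n) < n"
  using \<open>n > 0\<close>
proof (induction n rule: less_induct)
  case (less n)
  show ?case
  proof (cases "n div p = 0")
    case True
    with less.prems show ?thesis
      by (simp only: multiplicity_fact_div[OF p, of n]) simp
  next
    case False
    have "n div p < n"
      using less.prems prime_gt_1_nat[OF p] by simp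
    with False less.IH have "multiplicity p (fact (n div p)) < n div p"
      by blast
    moreover have "n div p * 2 \<le> n"
      using prime_ge_2_nat[OF p] by (metis div_times_less_eq_dividend le_trans mult_le_mono2)
    ultimately show ?thesis
      unfolding multiplicity_fact_div[OF p, of n] by linarith
  qed
qed

text \<open>A single prime factor of \<open>n\<close> suffices: its \<open>k\<close>-th power would
  also divide \<open>fact k\<close>.\<close>

lemma power_not_dvd_fact:
  fixes n k :: nat
  assumes "n \<ge> 2" and "k > 0"
  shows "\<not> n ^ k dvd fact k"
proof
  assume dvd: "n ^ k dvd fact k"
  obtain p where p: "Factorial_Ring.prime p" "p dvd n"
    using assms(1) prime_factor_nat[of n] by auto
  then have "p ^ k dvd fact k"
    using dvd dvd_power_same dvd_trans by blast
  then have "k \<le> multiplicity p (fact k)"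
    using p by (intro multiplicity_geI) auto
  then show False
    using multiplicity_fact_less[OF p(1) assms(2)] by simp
qed

section \<open>Symmetric groups and faithful actions\<close>

text \<open>Elements of \<open>BijGroup S\<close> are \<open>undefined\<close> outside
  \<open>S\<close>, whereas \<open>permutes\<close> demands the identity there. Switching the
  convention transports the known count of permutations.\<close>

lemma card_BijGroup:
  assumes "finite S"
  shows "card (carrier (BijGroup S)) = fact (card S)"
proof -
  have "bij_betw (\<lambda>f. restrict f S) {f. f permutes S} (Bij S)"
  proof (rule bij_betw_byWitness[where f' = "\<lambda>f x. if x \<in> S then f x else x"])
    show "\<forall>f\<in>{f. f permutes S}. (\<lambda>x. if x \<in> S then restrict f S x else x) = f"
      by (auto simp: permutes_not_in fun_eq_iff)
    show "\<forall>f\<in>Bij S. (\<lambda>x\<in>S. if x \<in> S then f x else x) = f"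
      by (auto simp: Bij_def extensional_def fun_eq_iff)
    show "(\<lambda>f. restrict f S) ` {f. f permutes S} \<subseteq> Bij S"
      by (auto simp: Bij_def permutes_imp_bij)
    show "(\<lambda>f x. if x \<in> S then f x else x) ` Bij S \<subseteq> {f. f permutes S}"
    proof (intro image_subsetI CollectI bij_imp_permutes)
      fix f assume "f \<in> Bij S"
      then show "bij_betw (\<lambda>x. if x \<in> S then f x else x) S S"
        by (simp add: Bij_def cong: bij_betw_cong)
    qed auto
  qed
  then have "card (Bij S) = card {f. f permutes S}"
    by (simp add: bij_betw_same_card)
  then show ?thesis
    using assms by (simp add: BijGroup_def card_permutations)
qed

text \<open>The image of an injective action is a subgroup of the symmetric group with as many
  elements as the acting group, so Lagrange's theorem applies.\<close>

lemma order_dvd_fact_if_faithful: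
  assumes act: "group_action H S \<phi>" and inj: "inj_on \<phi> (carrier H)" and fin: "finite S"
  shows "order H dvd fact (card S)"
proof -
  interpret group_hom H "BijGroup S" \<phi>
    using act by (simp add: group_action_def)
  have "card (\<phi> ` carrier H) dvd order (BijGroup S)"
    using group.lagrange[OF group_BijGroup img_is_subgroup] by (metis dvd_triv_right)
  then show ?thesis
    using card_image[OF inj] card_BijGroup[OF fin] by (simp add: order_def)
qed

section \<open>Counting points by a Cartesian decomposition\<close>

text \<open>A choice of one part from each partition, that is, an element of
  \<open>PiE E id\<close>, singles out a point; conversely a point lies in exactly one part of each
  partition. This identifies \<Omega> with the product of the partitions.\<close>

lemma card_cartesian_decomposition:
  assumes fin: "finite \<Omega>" and cd: "cartesian_decomposition \<Omega> E"
  shows "card \<Omega> = (\<Prod>\<Gamma>\<in>E. card \<Gamma>)"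
proof -
  have part: "partition_on \<Omega> \<Gamma>" if "\<Gamma> \<in> E" for \<Gamma>
    using cd that by (simp add: cartesian_decomposition_def)
  have finE: "finite E" and "E \<noteq> {}"
    using cd by (auto simp: cartesian_decomposition_def)
  have single: "\<exists>x. (\<Inter>\<Gamma>\<in>E. f \<Gamma>) = {x}" if "f \<in> PiE E id" for f
  proof -
    have "\<forall>\<Gamma>\<in>E. f \<Gamma> \<in> \<Gamma>" using that by auto
    then have "card (\<Inter>\<Gamma>\<in>E. f \<Gamma>) = 1"
      using cd unfolding cartesian_decomposition_def by blast
    then show ?thesis by (simp add: card_1_singleton_iff)
  qed
  have elem: "the_elem (\<Inter>\<Gamma>\<in>E. f \<Gamma>) \<in> f \<Gamma>" if f: "f \<in> PiE E id" and \<Gamma>: "\<Gamma> \<in> E" for f \<Gamma>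
  proof -
    obtain x where x: "(\<Inter>\<Gamma>\<in>E. f \<Gamma>) = {x}" using single[OF f] by blast
    then have "x \<in> f \<Gamma>" using \<Gamma> by blast
    then show ?thesis unfolding x by simp
  qed
  have "bij_betw (\<lambda>f. the_elem (\<Inter>\<Gamma>\<in>E. f \<Gamma>)) (PiE E id) \<Omega>"
    unfolding bij_betw_def
  proof (intro conjI inj_onI equalityI subsetI)
    fix f g
    assume f: "f \<in> PiE E id" and g: "g \<in> PiE E id"
      and eq: "the_elem (\<Inter>\<Gamma>\<in>E. f \<Gamma>) = the_elem (\<Inter>\<Gamma>\<in>E. g \<Gamma>)"
    show "f = g"
    proof (rule PiE_ext[OF f g])
      fix \<Gamma> assume "\<Gamma> \<in> E"
      moreover from this have "f \<Gamma> \<in> \<Gamma>" "g \<Gamma> \<in> \<Gamma>" using f g by auto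
      ultimately show "f \<Gamma> = g \<Gamma>"
        using elem[OF f] elem[OF g] eq partition_onD2[OF part] unfolding disjoint_def
        by (metis disjoint_iff)
    qed
  next
    fix x assume "x \<in> (\<lambda>f. the_elem (\<Inter>\<Gamma>\<in>E. f \<Gamma>)) ` PiE E id"
    then obtain f where f: "f \<in> PiE E id" "x = the_elem (\<Inter>\<Gamma>\<in>E. f \<Gamma>)" by blast
    obtain \<Gamma> where \<Gamma>: "\<Gamma> \<in> E" using \<open>E \<noteq> {}\<close> by blast
    then have "f \<Gamma> \<in> \<Gamma>" using f by auto
    then show "x \<in> \<Omega>" using elem[OF f(1) \<Gamma>] f(2) partition_onD1[OF part[OF \<Gamma>]] by blast
  next
    fix x assume x: "x \<in> \<Omega>"
    have "\<forall>\<Gamma>\<in>E. \<exists>\<gamma>\<in>\<Gamma>. x \<in> \<gamma>" using x partition_onD1[OF part] by blast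
    then obtain f where f: "\<forall>\<Gamma>\<in>E. f \<Gamma> \<in> \<Gamma> \<and> x \<in> f \<Gamma>" by metis
    let ?f = "restrict f E"
    have fE: "?f \<in> PiE E id" using f by auto
    obtain y where y: "(\<Inter>\<Gamma>\<in>E. ?f \<Gamma>) = {y}" using single[OF fE] by blast
    moreover have "x \<in> (\<Inter>\<Gamma>\<in>E. ?f \<Gamma>)" using f by auto
    ultimately have "x = the_elem (\<Inter>\<Gamma>\<in>E. ?f \<Gamma>)" unfolding y by simp
    then show "x \<in> (\<lambda>f. the_elem (\<Inter>\<Gamma>\<in>E. f \<Gamma>)) ` PiE E id" using fE by blast
  qed
  then have "card \<Omega> = card (PiE E id)"
    by (simp add: bij_betw_same_card)
  then show ?thesis
    using finE by (simp add: card_PiE)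
qed

text \<open>An abbreviation and not a definition, so that terms agree literally with those in
  \<open>G_invariant_CD\<close>.\<close>

abbreviation map_partition :: "('a \<Rightarrow> 'a) \<Rightarrow> 'a set set \<Rightarrow> 'a set set" where
  "map_partition g \<Gamma> \<equiv> (\<lambda>\<gamma>. g ` \<gamma>) ` \<Gamma>"

section \<open>The symmetric group acting on points, subsets and families of subsets\<close>

locale plinth_setting =
  fixes \<Omega> :: "'a set" and G M :: "('a \<Rightarrow> 'a) set" and \<omega> :: 'a
  assumes finite_\<Omega>: "finite \<Omega>"
    and subgroup_G: "subgroup G (BijGroup \<Omega>)"
    and minimal_M: "minimal_normal \<Omega> G M"
    and transitive_M: "transitive_on \<Omega> M"
    and \<omega>_in: "\<omega> \<in> \<Omega>"
begin

abbreviation B where "B \<equiv> BijGroup \<Omega>"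

sublocale B: group B
  by (rule group_BijGroup)

text \<open>Composition in \<open>BijGroup\<close> is restricted to \<Omega>, so this rule and its
  analogues for subsets and families of subsets ask that the argument live inside \<Omega>.\<close>

lemma mult_apply: "f \<in> carrier B \<Longrightarrow> g \<in> carrier B \<Longrightarrow> x \<in> \<Omega> \<Longrightarrow> (f \<otimes>\<^bsub>B\<^esub> g) x = f (g x)"
  by (simp add: BijGroup_def compose_def)

lemma one_apply: "x \<in> \<Omega> \<Longrightarrow> \<one>\<^bsub>B\<^esub> x = x"
  by (simp add: BijGroup_def)

lemma apply_in: "f \<in> carrier B \<Longrightarrow> x \<in> \<Omega> \<Longrightarrow> f x \<in> \<Omega>"
  by (auto simp: BijGroup_def dest: Bij_imp_funcset)

lemma inv_apply: "f \<in> carrier B \<Longrightarrow> x \<in> \<Omega> \<Longrightarrow> (inv\<^bsub>B\<^esub> f) (f x) = x"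
  using mult_apply[of "inv\<^bsub>B\<^esub> f" f x] by (simp add: one_apply)

lemma apply_inv: "f \<in> carrier B \<Longrightarrow> x \<in> \<Omega> \<Longrightarrow> f ((inv\<^bsub>B\<^esub> f) x) = x"
  using mult_apply[of f "inv\<^bsub>B\<^esub> f" x] by (simp add: one_apply)

lemma carrier_eqI:
  "f \<in> carrier B \<Longrightarrow> g \<in> carrier B \<Longrightarrow> (\<And>x. x \<in> \<Omega> \<Longrightarrow> f x = g x) \<Longrightarrow> f = g"
  by (auto simp: BijGroup_def Bij_def intro: extensionalityI)

lemma mult_image:
  "f \<in> carrier B \<Longrightarrow> g \<in> carrier B \<Longrightarrow> \<gamma> \<subseteq> \<Omega> \<Longrightarrow> (f \<otimes>\<^bsub>B\<^esub> g) ` \<gamma> = f ` g ` \<gamma>"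
  by (force simp: mult_apply image_image subset_iff)

lemma one_image: "\<gamma> \<subseteq> \<Omega> \<Longrightarrow> \<one>\<^bsub>B\<^esub> ` \<gamma> = \<gamma>"
  by (force simp: one_apply subset_iff)

lemma image_in: "f \<in> carrier B \<Longrightarrow> \<gamma> \<subseteq> \<Omega> \<Longrightarrow> f ` \<gamma> \<subseteq> \<Omega>"
  using apply_in by blast

lemma inv_image: "f \<in> carrier B \<Longrightarrow> \<gamma> \<subseteq> \<Omega> \<Longrightarrow> (inv\<^bsub>B\<^esub> f) ` f ` \<gamma> = \<gamma>"
  using mult_image[of "inv\<^bsub>B\<^esub> f" f \<gamma>] by (simp add: one_image)

lemma image_inv: "f \<in> carrier B \<Longrightarrow> \<gamma> \<subseteq> \<Omega> \<Longrightarrow> f ` (inv\<^bsub>B\<^esub> f) ` \<gamma> = \<gamma>"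
  using mult_image[of f "inv\<^bsub>B\<^esub> f" \<gamma>] by (simp add: one_image)

lemma mult_map_partition:
  "f \<in> carrier B \<Longrightarrow> g \<in> carrier B \<Longrightarrow> \<Gamma> \<subseteq> Pow \<Omega> \<Longrightarrow>
    map_partition (f \<otimes>\<^bsub>B\<^esub> g) \<Gamma> = map_partition f (map_partition g \<Gamma>)"
  unfolding image_image[of "\<lambda>\<gamma>. f ` \<gamma>"] by (intro image_cong refl mult_image) auto

lemma one_map_partition: "\<Gamma> \<subseteq> Pow \<Omega> \<Longrightarrow> map_partition \<one>\<^bsub>B\<^esub> \<Gamma> = \<Gamma>"
  by (force simp: one_image subset_iff)

lemma map_partition_in: "f \<in> carrier B \<Longrightarrow> \<Gamma> \<subseteq> Pow \<Omega> \<Longrightarrow> map_partition f \<Gamma> \<subseteq> Pow \<Omega>"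
  using image_in by blast

lemma inv_map_partition:
  "f \<in> carrier B \<Longrightarrow> \<Gamma> \<subseteq> Pow \<Omega> \<Longrightarrow> map_partition (inv\<^bsub>B\<^esub> f) (map_partition f \<Gamma>) = \<Gamma>"
  using mult_map_partition[of "inv\<^bsub>B\<^esub> f" f \<Gamma>] by (simp add: one_map_partition)

lemma map_partition_inv:
  "f \<in> carrier B \<Longrightarrow> \<Gamma> \<subseteq> Pow \<Omega> \<Longrightarrow> map_partition f (map_partition (inv\<^bsub>B\<^esub> f) \<Gamma>) = \<Gamma>"
  using mult_map_partition[of f "inv\<^bsub>B\<^esub> f" \<Gamma>] by (simp add: one_map_partition)

section \<open>Closure and normality properties of \<open>G\<close> and \<open>M\<close>\<close>

lemma group_G: "group (B\<lparr>carrier := G\<rparr>)"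
  using subgroup_G by (rule B.subgroup_imp_group)

text \<open>Replacing the carrier leaves multiplication untouched, and inverses in a subgroup agree
  with those of \<open>B\<close>. Normality in \<open>G\<close> can thus be handled entirely with
  the operations of \<open>B\<close>.\<close>

lemma normal_G_iff:
  "N \<lhd> B\<lparr>carrier := G\<rparr> \<longleftrightarrow>
    subgroup N B \<and> N \<subseteq> G \<and> (\<forall>g\<in>G. \<forall>n\<in>N. g \<otimes>\<^bsub>B\<^esub> n \<otimes>\<^bsub>B\<^esub> inv\<^bsub>B\<^esub> g \<in> N)"
proof -
  have "subgroup N (B\<lparr>carrier := G\<rparr>) \<longleftrightarrow> subgroup N B \<and> N \<subseteq> G"
    using B.subgroup_incl[OF _ subgroup_G] B.incl_subgroup[OF subgroup_G]
    by (metis partial_object.select_convs(1) partial_object.surjective partial_object.update_convs(1) subgroup.subset)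
  then show ?thesis
    using B.m_inv_consistent[OF subgroup_G] by (simp add: group.normal_inv_iff[OF group_G])
qed

lemma subgroup_M: "subgroup M B" and M_le_G: "M \<subseteq> G"
  and conj_M: "g \<in> G \<Longrightarrow> m \<in> M \<Longrightarrow> g \<otimes>\<^bsub>B\<^esub> m \<otimes>\<^bsub>B\<^esub> inv\<^bsub>B\<^esub> g \<in> M"
  using minimal_M by (auto simp: minimal_normal_def normal_G_iff)

lemma G_carrier: "g \<in> G \<Longrightarrow> g \<in> carrier B"
  using subgroup_G subgroup.subset by blast

lemma M_carrier: "m \<in> M \<Longrightarrow> m \<in> carrier B"
  using subgroup_M subgroup.subset by blast

lemma G_inv: "g \<in> G \<Longrightarrow> inv\<^bsub>B\<^esub> g \<in> G"
  using subgroup.m_inv_closed[OF subgroup_G] .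

lemma M_inv: "m \<in> M \<Longrightarrow> inv\<^bsub>B\<^esub> m \<in> M"
  using subgroup.m_inv_closed[OF subgroup_M] .

lemma M_mult: "m \<in> M \<Longrightarrow> n \<in> M \<Longrightarrow> m \<otimes>\<^bsub>B\<^esub> n \<in> M"
  using subgroup.m_closed[OF subgroup_M] .

lemma M_one: "\<one>\<^bsub>B\<^esub> \<in> M"
  using subgroup.one_closed[OF subgroup_M] .

lemma conj_M': "g \<in> G \<Longrightarrow> m \<in> M \<Longrightarrow> inv\<^bsub>B\<^esub> g \<otimes>\<^bsub>B\<^esub> m \<otimes>\<^bsub>B\<^esub> g \<in> M"
  using conj_M[OF G_inv] by (simp add: G_carrier)

lemma mult_conj_inv:
  assumes "g \<in> carrier B" "f \<in> carrier B"
  shows "g \<otimes>\<^bsub>B\<^esub> (inv\<^bsub>B\<^esub> g \<otimes>\<^bsub>B\<^esub> f \<otimes>\<^bsub>B\<^esub> g) \<otimes>\<^bsub>B\<^esub> inv\<^bsub>B\<^esub> g = f"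
proof -
  have "g \<otimes>\<^bsub>B\<^esub> (inv\<^bsub>B\<^esub> g \<otimes>\<^bsub>B\<^esub> f) = f"
    using assms by (simp add: B.m_assoc[symmetric])
  then show ?thesis using assms by (simp add: B.m_assoc)
qed

section \<open>Transitivity of the plinth and its action on partitions\<close>

lemma M_transitive: "\<alpha> \<in> \<Omega> \<Longrightarrow> \<beta> \<in> \<Omega> \<Longrightarrow> \<exists>m\<in>M. m \<alpha> = \<beta>"
  using transitive_M by (simp add: transitive_on_def)

text \<open>By transitivity the orbit of \<omega> is all of \<Omega>, so this is the
  orbit-stabiliser theorem.\<close>

lemma card_dvd_order_M: "card \<Omega> dvd card M"
proof -
  have "group_hom (B\<lparr>carrier := M\<rparr>) B id"
    using B.subgroup_imp_group[OF subgroup_M] M_carrier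
    by (auto simp: group_hom_def group_hom_axioms_def hom_def B.is_group)
  then interpret act: group_action "B\<lparr>carrier := M\<rparr>" \<Omega> id
    by (simp add: group_action_def)
  have "orbit (B\<lparr>carrier := M\<rparr>) id \<omega> = \<Omega>"
    using M_transitive[OF \<omega>_in] apply_in[OF M_carrier \<omega>_in] by (force simp: orbit_def)
  then show ?thesis
    using act.orbit_stabilizer_theorem[OF \<omega>_in] by (metis dvd_triv_left order_def partial_object.select_convs(1) partial_object.surjective partial_object.update_convs(1))
qed

text \<open>The kernel of the action of \<open>M\<close> on \<open>S\<close> is normal in
  \<open>G\<close> because \<open>S\<close> is \<open>G\<close>-invariant, so minimality makes it
  all of \<open>M\<close> or trivial. In the latter case \<open>M\<close> embeds in the symmetric
  group on \<open>S\<close>.\<close>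

lemma M_acts_trivially_or_faithfully:
  assumes S: "S \<subseteq> Pow (Pow \<Omega>)" and inv: "\<And>g \<Gamma>. g \<in> G \<Longrightarrow> \<Gamma> \<in> S \<Longrightarrow> map_partition g \<Gamma> \<in> S"
    and fin: "finite S"
  shows "(\<forall>m\<in>M. \<forall>\<Gamma>\<in>S. map_partition m \<Gamma> = \<Gamma>) \<or> card M dvd fact (card S)"
proof -
  define N where "N = {m \<in> M. \<forall>\<Gamma>\<in>S. map_partition m \<Gamma> = \<Gamma>}"
  have S': "\<Gamma> \<subseteq> Pow \<Omega>" if "\<Gamma> \<in> S" for \<Gamma> using S that by blast
  have fixed_inv: "map_partition (inv\<^bsub>B\<^esub> m) \<Gamma> = \<Gamma>" if "m \<in> N" "\<Gamma> \<in> S" for m \<Gamma>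
    using that inv_map_partition[OF M_carrier S', of m \<Gamma>] by (simp add: N_def)
  have "subgroup N B"
  proof (rule B.subgroupI)
    show "N \<subseteq> carrier B" using M_carrier by (auto simp: N_def)
    have "\<one>\<^bsub>B\<^esub> \<in> N"
      unfolding N_def using M_one one_map_partition[OF S'] by (simp del: image_image)
    then show "N \<noteq> {}" by blast
  next
    fix a assume "a \<in> N"
    then show "inv\<^bsub>B\<^esub> a \<in> N"
      using fixed_inv[of a] M_inv[of a] by (simp add: N_def)
  next
    fix a b assume "a \<in> N" "b \<in> N"
    then show "a \<otimes>\<^bsub>B\<^esub> b \<in> N"
      by (simp add: N_def M_mult mult_map_partition M_carrier S')
  qed
  moreover have "N \<subseteq> M" by (auto simp: N_def)
  moreover have "g \<otimes>\<^bsub>B\<^esub> n \<otimes>\<^bsub>B\<^esub> inv\<^bsub>B\<^esub> g \<in> N" if g: "g \<in> G" and n: "n \<in> N" for g n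
  proof -
    have fixed: "map_partition (g \<otimes>\<^bsub>B\<^esub> n \<otimes>\<^bsub>B\<^esub> inv\<^bsub>B\<^esub> g) \<Gamma> = \<Gamma>" if \<Gamma>: "\<Gamma> \<in> S" for \<Gamma>
    proof -
      have c: "g \<in> carrier B" "n \<in> carrier B" "inv\<^bsub>B\<^esub> g \<in> carrier B"
        using g n by (auto simp: N_def intro: G_carrier M_carrier)
      \<comment> \<open>Invariance of \<open>S\<close> is what makes the kernel normal: the preimage
        of \<Gamma> under \<open>g\<close> lies in \<open>S\<close> again, so \<open>n\<close> fixes
        it and \<open>g\<close> brings it back to \<Gamma>.\<close>
      have D: "map_partition (inv\<^bsub>B\<^esub> g) \<Gamma> \<in> S" using inv[OF G_inv[OF g] \<Gamma>] .
      have "map_partition (g \<otimes>\<^bsub>B\<^esub> n \<otimes>\<^bsub>B\<^esub> inv\<^bsub>B\<^esub> g) \<Gamma>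
          = map_partition g (map_partition n (map_partition (inv\<^bsub>B\<^esub> g) \<Gamma>))"
        using c S'[OF \<Gamma>] S'[OF D] by (simp only: mult_map_partition B.m_closed)
      also have "map_partition n (map_partition (inv\<^bsub>B\<^esub> g) \<Gamma>) = map_partition (inv\<^bsub>B\<^esub> g) \<Gamma>"
        using n D by (simp add: N_def del: image_image)
      finally show ?thesis
        using map_partition_inv[OF c(1) S'[OF \<Gamma>]] by simp
    qed
    have "n \<in> M" using n by (simp add: N_def)
    then show ?thesis
      unfolding N_def by (intro CollectI conjI ballI conj_M[OF g] fixed)
  qed
  ultimately have "N = {\<one>\<^bsub>B\<^esub>} \<or> N = M"
    using minimal_M M_le_G by (simp add: minimal_normal_def normal_G_iff)
  then show ?thesis
  proof
    assume "N = M"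
    then have "\<forall>m\<in>M. m \<in> N" by simp
    then have "\<forall>m\<in>M. \<forall>\<Gamma>\<in>S. map_partition m \<Gamma> = \<Gamma>"
      by (simp only: N_def mem_Collect_eq) simp
    then show ?thesis ..
  next
    assume N1: "N = {\<one>\<^bsub>B\<^esub>}"
    \<comment> \<open>The permutation representation of \<open>M\<close> on \<open>S\<close>,
      restricted to \<open>S\<close> because elements of \<open>BijGroup S\<close> must be
      extensional.\<close>
    define \<phi> where "\<phi> m = (\<lambda>\<Gamma>\<in>S. map_partition m \<Gamma>)" for m :: "'a \<Rightarrow> 'a"
    have invM: "map_partition m \<Gamma> \<in> S" if "m \<in> M" "\<Gamma> \<in> S" for m \<Gamma>
      using inv that M_le_G by blast
    have \<phi>_Bij: "\<phi> m \<in> Bij S" if m: "m \<in> M" for m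
    proof -
      have "bij_betw (\<lambda>\<Gamma>. map_partition m \<Gamma>) S S"
      proof (rule bij_betw_byWitness[where f' = "\<lambda>\<Gamma>. map_partition (inv\<^bsub>B\<^esub> m) \<Gamma>"])
        show "\<forall>\<Gamma>\<in>S. map_partition (inv\<^bsub>B\<^esub> m) (map_partition m \<Gamma>) = \<Gamma>"
          using inv_map_partition[OF M_carrier[OF m] S'] by blast
        show "\<forall>\<Gamma>\<in>S. map_partition m (map_partition (inv\<^bsub>B\<^esub> m) \<Gamma>) = \<Gamma>"
          using map_partition_inv[OF M_carrier[OF m] S'] by blast
      qed (use invM m M_inv in blast)+
      then show ?thesis
        unfolding \<phi>_def Bij_def by (simp cong: bij_betw_cong)
    qed
    have "\<phi> (m \<otimes>\<^bsub>B\<^esub> n) = \<phi> m \<otimes>\<^bsub>BijGroup S\<^esub> \<phi> n" if mn: "m \<in> M" "n \<in> M" for m n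
    proof -
      have "\<phi> m \<otimes>\<^bsub>BijGroup S\<^esub> \<phi> n = compose S (\<phi> m) (\<phi> n)"
        using \<phi>_Bij mn by (simp add: BijGroup_def)
      also have "\<dots> = \<phi> (m \<otimes>\<^bsub>B\<^esub> n)"
        unfolding compose_def \<phi>_def
      proof (rule restrict_ext)
        fix \<Gamma> assume \<Gamma>: "\<Gamma> \<in> S"
        show "restrict (map_partition m) S (restrict (map_partition n) S \<Gamma>)
            = map_partition (m \<otimes>\<^bsub>B\<^esub> n) \<Gamma>"
          unfolding mult_map_partition[OF M_carrier[OF mn(1)] M_carrier[OF mn(2)] S'[OF \<Gamma>]]
          using \<Gamma> invM mn by (simp only: restrict_apply' )
      qed
      finally show ?thesis by simp
    qed
    then have "\<phi> \<in> hom (B\<lparr>carrier := M\<rparr>) (BijGroup S)"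
      using \<phi>_Bij by (auto simp: hom_def BijGroup_def)
    then have act: "group_action (B\<lparr>carrier := M\<rparr>) S \<phi>"
      using B.subgroup_imp_group[OF subgroup_M] group_BijGroup
      by (simp add: group_action_def group_hom_def group_hom_axioms_def)
    have "inj_on \<phi> M"
    proof (rule inj_onI)
      fix m n assume m: "m \<in> M" and n: "n \<in> M" and eq: "\<phi> m = \<phi> n"
      have "map_partition (inv\<^bsub>B\<^esub> m \<otimes>\<^bsub>B\<^esub> n) \<Gamma> = \<Gamma>" if \<Gamma>: "\<Gamma> \<in> S" for \<Gamma>
      proof -
        have "map_partition m \<Gamma> = map_partition n \<Gamma>"
          using fun_cong[OF eq, of \<Gamma>] \<Gamma> by (simp add: \<phi>_def)
        then show ?thesis
          using mult_map_partition[OF M_carrier[OF M_inv[OF m]] M_carrier[OF n] S'[OF \<Gamma>]]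
            inv_map_partition[OF M_carrier[OF m] S'[OF \<Gamma>]] by simp
      qed
      then have "inv\<^bsub>B\<^esub> m \<otimes>\<^bsub>B\<^esub> n \<in> N"
        using m n by (simp add: N_def M_mult M_inv)
      then have "inv\<^bsub>B\<^esub> m \<otimes>\<^bsub>B\<^esub> n = \<one>\<^bsub>B\<^esub>"
        using N1 by blast
      then have "inv\<^bsub>B\<^esub> (inv\<^bsub>B\<^esub> m) = n"
        using B.inv_equality by (metis B.inv_closed B.inv_comm M_carrier m n)
      then show "m = n"
        using M_carrier[OF m] by simp
    qed
    then show ?thesis
      using order_dvd_fact_if_faithful[OF act _ fin] by (simp add: order_def)
  qed
qed

lemma M_fixes_partition:
  assumes E: "E \<in> CD \<Omega> G" and \<Gamma>: "\<Gamma> \<in> E" and m: "m \<in> M"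
  shows "map_partition m \<Gamma> = \<Gamma>"
proof -
  have cd: "cartesian_decomposition \<Omega> E"
    and inv: "\<And>g \<Gamma>. g \<in> G \<Longrightarrow> \<Gamma> \<in> E \<Longrightarrow> map_partition g \<Gamma> \<in> E"
    using E by (auto simp: CD_def G_invariant_CD_def)
  have finE: "finite E" and part: "\<And>\<Gamma>. \<Gamma> \<in> E \<Longrightarrow> partition_on \<Omega> \<Gamma>"
    using cd by (auto simp: cartesian_decomposition_def)
  have sub: "\<Gamma> \<subseteq> Pow \<Omega>" if "\<Gamma> \<in> E" for \<Gamma>
    using partition_onD1[OF part[OF that]] by blast
  \<comment> \<open>\<open>G\<close> preserves the number of parts, so \<open>S\<close> is an
    invariant family; the equal numbers of parts turn the product over \<open>S\<close> into a power
    of \<open>card \<Gamma>\<close>.\<close>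
  define S where "S = {\<Delta> \<in> E. card \<Delta> = card \<Gamma>}"
  have finS: "finite S" using finE by (simp add: S_def)
  have inv_card: "card (map_partition g \<Delta>) = card \<Delta>" if "g \<in> G" "\<Delta> \<in> E" for g \<Delta>
  proof (rule card_image)
    show "inj_on (\<lambda>\<gamma>. g ` \<gamma>) \<Delta>"
      using inv_image[OF G_carrier[OF that(1)]] sub[OF that(2)]
      by (intro inj_on_inverseI[where g = "\<lambda>\<gamma>. (inv\<^bsub>B\<^esub> g) ` \<gamma>"]) blast
  qed
  have "card M dvd fact (card S)" if "map_partition m \<Gamma> \<noteq> \<Gamma>"
  proof -
    have "(\<forall>m\<in>M. \<forall>\<Delta>\<in>S. map_partition m \<Delta> = \<Delta>) \<or> card M dvd fact (card S)"
    proof (rule M_acts_trivially_or_faithfully[OF _ _ finS])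
      show "S \<subseteq> Pow (Pow \<Omega>)" using sub by (auto simp: S_def)
      show "map_partition g \<Delta> \<in> S" if "g \<in> G" "\<Delta> \<in> S" for g \<Delta>
        using that inv inv_card unfolding S_def by simp
    qed
    moreover have "\<Gamma> \<in> S" using \<Gamma> by (simp add: S_def)
    ultimately show ?thesis using m that by blast
  qed
  moreover have "card \<Gamma> ^ card S dvd card M"
  proof -
    have "card \<Gamma> ^ card S = (\<Prod>\<Delta>\<in>S. card \<Delta>)"
      by (simp add: S_def)
    also have "\<dots> dvd card \<Omega>"
      unfolding card_cartesian_decomposition[OF finite_\<Omega> cd]
      using finE by (intro prod_dvd_prod_subset) (auto simp: S_def)
    finally show ?thesis
      using card_dvd_order_M dvd_trans by blast
  qed
  moreover have "card S > 0"
    using finS \<Gamma> by (auto simp: S_def card_gt_0_iff)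
  ultimately have "map_partition m \<Gamma> = \<Gamma>" if "card \<Gamma> \<ge> 2"
    using power_not_dvd_fact[OF that] dvd_trans by blast
  \<comment> \<open>With a single part the power is 1 and divisibility says nothing, but the
    partition is then \<open>{\<Omega>}\<close>, which every permutation fixes. Having no parts is
    excluded by \<omega>.\<close>
  moreover have "map_partition m \<Gamma> = \<Gamma>" if "\<not> card \<Gamma> \<ge> 2"
  proof -
    have "finite \<Gamma>" using finite_elements[OF finite_\<Omega> part[OF \<Gamma>]] .
    moreover have "\<Gamma> \<noteq> {}" using partition_onD1[OF part[OF \<Gamma>]] \<omega>_in by auto
    ultimately have "card \<Gamma> = 1" using that by (metis One_nat_def card_0_eq less_2_cases not_le)
    then obtain \<gamma> where "\<Gamma> = {\<gamma>}" by (auto simp: card_1_singleton_iff)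
    then have "\<Gamma> = {\<Omega>}" using partition_onD1[OF part[OF \<Gamma>]] by simp
    moreover have "m ` \<Omega> = \<Omega>"
      using image_in[OF M_carrier[OF m]] image_inv[OF M_carrier[OF m], of \<Omega>]
        image_in[OF M_carrier[OF M_inv[OF m]], of \<Omega>] by blast
    ultimately show ?thesis by simp
  qed
  ultimately show ?thesis by blast
qed

section \<open>Stabilisers of parts and block systems\<close>

lemma subgroup_set_stab:
  assumes \<gamma>: "\<gamma> \<subseteq> \<Omega>"
  shows "subgroup (set_stab M \<gamma>) B"
proof (rule B.subgroupI)
  show "set_stab M \<gamma> \<subseteq> carrier B"
    using M_carrier by (auto simp: set_stab_def)
  show "set_stab M \<gamma> \<noteq> {}"
    using M_one one_image[OF \<gamma>] by (auto simp: set_stab_def)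
  show "inv\<^bsub>B\<^esub> a \<in> set_stab M \<gamma>" if "a \<in> set_stab M \<gamma>" for a
    using that M_inv inv_image[OF M_carrier \<gamma>, of a] by (simp add: set_stab_def)
  show "a \<otimes>\<^bsub>B\<^esub> b \<in> set_stab M \<gamma>" if "a \<in> set_stab M \<gamma>" "b \<in> set_stab M \<gamma>" for a b
    using that \<gamma> by (simp add: set_stab_def M_mult mult_image M_carrier)
qed

definition conj_set :: "('a \<Rightarrow> 'a) \<Rightarrow> ('a \<Rightarrow> 'a) set \<Rightarrow> ('a \<Rightarrow> 'a) set" where
  "conj_set g K = (\<lambda>k. g \<otimes>\<^bsub>B\<^esub> k \<otimes>\<^bsub>B\<^esub> inv\<^bsub>B\<^esub> g) ` K"

definition block :: "('a \<Rightarrow> 'a) set \<Rightarrow> 'a set" where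
  "block K = (\<lambda>k. k \<omega>) ` K"

text \<open>The classical correspondence between subgroups of \<open>M\<close> containing the
  stabiliser of \<omega> and \<open>M\<close>-invariant partitions of \<Omega>. Applied to each
  member of a Cartesian system, it provides the inverse map.\<close>

definition block_system :: "('a \<Rightarrow> 'a) set \<Rightarrow> 'a set set" where
  "block_system K = (\<lambda>m. m ` block K) ` M"

section \<open>From an invariant Cartesian decomposition to a Cartesian system\<close>

context
  fixes E assumes E: "E \<in> CD \<Omega> G"
begin

lemma E_decomposition: "cartesian_decomposition \<Omega> E"
  using E by (simp add: CD_def)

lemma E_partition: "\<Gamma> \<in> E \<Longrightarrow> partition_on \<Omega> \<Gamma>"
  using E_decomposition by (simp add: cartesian_decomposition_def)

lemma block_subset: "\<Gamma> \<in> E \<Longrightarrow> \<gamma> \<in> \<Gamma> \<Longrightarrow> \<gamma> \<subseteq> \<Omega>"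
  using partition_onD1[OF E_partition] by blast

lemma block_unique: "\<Gamma> \<in> E \<Longrightarrow> \<gamma> \<in> \<Gamma> \<Longrightarrow> \<delta> \<in> \<Gamma> \<Longrightarrow> x \<in> \<gamma> \<Longrightarrow> x \<in> \<delta> \<Longrightarrow> \<gamma> = \<delta>"
  using partition_onD2[OF E_partition] unfolding disjoint_def by blast

lemma M_image_block: "\<Gamma> \<in> E \<Longrightarrow> \<gamma> \<in> \<Gamma> \<Longrightarrow> m \<in> M \<Longrightarrow> m ` \<gamma> \<in> \<Gamma>"
  using M_fixes_partition[OF E] by blast

text \<open>\<open>M\<close> permutes the parts of \<Gamma>, so a part that meets its image equals
  it. Membership in the stabiliser can therefore be tested at a single point.\<close>

lemma block_mem_set_stab:
  assumes "\<Gamma> \<in> E" "\<gamma> \<in> \<Gamma>" "x \<in> \<gamma>" "m \<in> M" "m x \<in> \<gamma>"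
  shows "m \<in> set_stab M \<gamma>"
  using block_unique[OF assms(1) M_image_block[OF assms(1,2,4)] assms(2), of "m x"] assms
  by (simp add: set_stab_def)

lemma block_set_stab:
  assumes "\<Gamma> \<in> E" "\<gamma> \<in> \<Gamma>" "\<omega> \<in> \<gamma>"
  shows "block (set_stab M \<gamma>) = \<gamma>"
proof (intro equalityI subsetI)
  fix x assume "x \<in> block (set_stab M \<gamma>)"
  then show "x \<in> \<gamma>" using assms by (auto simp: block_def set_stab_def)
next
  fix x assume x: "x \<in> \<gamma>"
  then obtain m where "m \<in> M" "m \<omega> = x"
    using M_transitive[OF \<omega>_in] block_subset assms by blast
  moreover from this have "m \<in> set_stab M \<gamma>"
    using block_mem_set_stab assms x by blast
  ultimately show "x \<in> block (set_stab M \<gamma>)" by (auto simp: block_def)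
qed

text \<open>Transitivity on points makes \<open>M\<close> transitive on the parts, so the translates
  of one part exhaust the partition. Hence the stabiliser alone determines \<Gamma>.\<close>

lemma block_system_set_stab:
  assumes "\<Gamma> \<in> E" "\<gamma> \<in> \<Gamma>" "\<omega> \<in> \<gamma>"
  shows "block_system (set_stab M \<gamma>) = \<Gamma>"
  unfolding block_system_def block_set_stab[OF assms]
proof (intro equalityI subsetI)
  fix \<delta> assume "\<delta> \<in> (\<lambda>m. m ` \<gamma>) ` M"
  then show "\<delta> \<in> \<Gamma>" using M_image_block assms by blast
next
  fix \<delta> assume \<delta>: "\<delta> \<in> \<Gamma>"
  then have "\<delta> \<noteq> {}" using partition_onD3[OF E_partition[OF assms(1)]] by blast
  then obtain x where x: "x \<in> \<delta>" "x \<in> \<Omega>"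
    using block_subset[OF assms(1) \<delta>] by blast
  then obtain m where m: "m \<in> M" "m \<omega> = x"
    using M_transitive[OF \<omega>_in] by blast
  then have "m ` \<gamma> = \<delta>"
    using block_unique[OF assms(1) M_image_block \<delta>] assms x by blast
  then show "\<delta> \<in> (\<lambda>m. m ` \<gamma>) ` M" using m by blast
qed

lemma image_block_system_K_omega: "block_system ` K_omega M \<omega> E = E"
proof (intro equalityI subsetI)
  fix \<Gamma> assume "\<Gamma> \<in> block_system ` K_omega M \<omega> E"
  then show "\<Gamma> \<in> E" using block_system_set_stab by (auto simp: K_omega_def)
next
  fix \<Gamma> assume \<Gamma>: "\<Gamma> \<in> E"
  then obtain \<gamma> where \<gamma>: "\<gamma> \<in> \<Gamma>" "\<omega> \<in> \<gamma>"
    using partition_onD1[OF E_partition] \<omega>_in by blast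
  then have "set_stab M \<gamma> \<in> K_omega M \<omega> E"
    using \<Gamma> by (auto simp: K_omega_def)
  then show "\<Gamma> \<in> block_system ` K_omega M \<omega> E"
    using block_system_set_stab[OF \<Gamma> \<gamma>] by blast
qed

text \<open>An element of \<open>M\<close> stabilises the part through \<omega> exactly if it sends
  \<omega> into that part. Since these parts meet only in \<omega>, the stabilisers intersect in the
  point stabiliser; the factorisations come from intersecting one translated part with the other
  parts through \<omega>.\<close>

lemma cartesian_system_K_omega: "cartesian_system \<Omega> M \<omega> (K_omega M \<omega> E)"
proof -
  have "\<forall>\<Gamma>\<in>E. \<exists>\<gamma>\<in>\<Gamma>. \<omega> \<in> \<gamma>"
    using partition_onD1[OF E_partition] \<omega>_in by blast
  then obtain c where c: "\<And>\<Gamma>. \<Gamma> \<in> E \<Longrightarrow> c \<Gamma> \<in> \<Gamma>" "\<And>\<Gamma>. \<Gamma> \<in> E \<Longrightarrow> \<omega> \<in> c \<Gamma>" by metis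
  define S where "S \<Gamma> = set_stab M (c \<Gamma>)" for \<Gamma>
  have K: "K_omega M \<omega> E = S ` E"
  proof (intro equalityI subsetI)
    fix K assume "K \<in> K_omega M \<omega> E"
    then obtain \<Gamma> \<gamma> where "\<Gamma> \<in> E" "\<gamma> \<in> \<Gamma>" "\<omega> \<in> \<gamma>" "K = set_stab M \<gamma>"
      by (auto simp: K_omega_def)
    then show "K \<in> S ` E" using block_unique[of \<Gamma> \<gamma> "c \<Gamma>" \<omega>] c by (auto simp: S_def)
  next
    fix K assume "K \<in> S ` E"
    then show "K \<in> K_omega M \<omega> E" using c by (auto simp: K_omega_def S_def)
  qed
  \<comment> \<open>Distinct partitions have distinct stabilisers, so the system has as many members
    as \<open>E\<close>.\<close>
  have inj: "inj_on S E"
    using block_system_set_stab c unfolding S_def by (intro inj_on_inverseI[where g = block_system]) blast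
  have finE: "finite E" and card2: "card E \<ge> 2" and neE: "E \<noteq> {}"
    and single: "\<And>f. (\<forall>\<Gamma>\<in>E. f \<Gamma> \<in> \<Gamma>) \<Longrightarrow> card (\<Inter>\<Gamma>\<in>E. f \<Gamma>) = 1"
    using E_decomposition by (auto simp: cartesian_decomposition_def)
  have sub: "subgroup (S \<Gamma>) B" if "\<Gamma> \<in> E" for \<Gamma>
    unfolding S_def using subgroup_set_stab block_subset c that by blast
  have SM: "S \<Gamma> \<subseteq> M" for \<Gamma> by (auto simp: S_def set_stab_def)
  have S_iff: "m \<in> S \<Gamma> \<longleftrightarrow> m \<omega> \<in> c \<Gamma>" if "m \<in> M" "\<Gamma> \<in> E" for m \<Gamma>
    using block_mem_set_stab[of \<Gamma> "c \<Gamma>" \<omega> m] c that by (auto simp: S_def set_stab_def)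
  have Inter: "(\<Inter>\<Gamma>\<in>E. S \<Gamma>) = stab M \<omega>"
  proof -
    have "card (\<Inter>\<Gamma>\<in>E. c \<Gamma>) = 1"
      using c(1) by (intro single ballI)
    then obtain x where "(\<Inter>\<Gamma>\<in>E. c \<Gamma>) = {x}"
      by (rule card_1_singletonE)
    moreover have "\<omega> \<in> (\<Inter>\<Gamma>\<in>E. c \<Gamma>)" using c(2) by simp
    ultimately have Inter_c: "(\<Inter>\<Gamma>\<in>E. c \<Gamma>) = {\<omega>}" by simp
    have mem_iff: "(\<forall>\<Gamma>\<in>E. m \<in> S \<Gamma>) \<longleftrightarrow> m \<omega> = \<omega>" if "m \<in> M" for m
    proof -
      have "(\<forall>\<Gamma>\<in>E. m \<in> S \<Gamma>) \<longleftrightarrow> m \<omega> \<in> (\<Inter>\<Gamma>\<in>E. c \<Gamma>)"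
        using S_iff[OF that] by simp
      then show ?thesis by (simp add: Inter_c)
    qed
    have "m \<in> (\<Inter>\<Gamma>\<in>E. S \<Gamma>) \<longleftrightarrow> m \<in> stab M \<omega>" for m
    proof (cases "m \<in> M")
      case True
      then show ?thesis using mem_iff by (simp add: stab_def)
    next
      case False
      then show ?thesis using SM neE by (auto simp: stab_def)
    qed
    then show ?thesis by blast
  qed
  have factor: "S \<Gamma> <#>\<^bsub>B\<^esub> (\<Inter>(S ` E - {S \<Gamma>})) = M" if \<Gamma>: "\<Gamma> \<in> E" for \<Gamma>
  proof (intro equalityI subsetI)
    \<comment> \<open>The intersection of an empty family would be \<open>UNIV\<close> and would not
      lie in \<open>M\<close>.\<close>
    have "S ` E - {S \<Gamma>} \<noteq> {}"
    proof
      assume "S ` E - {S \<Gamma>} = {}"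
      then have "S ` E \<subseteq> {S \<Gamma>}" by blast
      then have "card (S ` E) \<le> 1" using card_mono[of "{S \<Gamma>}"] by simp
      then show False using card2 card_image[OF inj] by simp
    qed
    then have IM: "\<Inter>(S ` E - {S \<Gamma>}) \<subseteq> M" using SM by blast
    fix m assume "m \<in> S \<Gamma> <#>\<^bsub>B\<^esub> (\<Inter>(S ` E - {S \<Gamma>}))"
    then obtain k l where "k \<in> S \<Gamma>" "l \<in> \<Inter>(S ` E - {S \<Gamma>})" "m = k \<otimes>\<^bsub>B\<^esub> l"
      unfolding set_mult_def by blast
    then show "m \<in> M" using M_mult SM IM by blast
  next
    fix m assume m: "m \<in> M"
    let ?n = "inv\<^bsub>B\<^esub> m"
    have n: "?n \<in> M" using M_inv m by blast
    \<comment> \<open>The common point \<open>x\<close> is written as \<open>l \<omega>\<close>.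
      Then \<open>l\<close> lies in every stabiliser other than that of \<Gamma>, while
      \<open>m\<close> takes \<open>x\<close> into the part of \<Gamma> through \<omega>; so
      \<open>m\<close> is the product of \<open>m l\<close> in \<open>S \<Gamma>\<close> and the
      inverse of \<open>l\<close>.\<close>
    have "card (\<Inter>\<Delta>\<in>E. if \<Delta> = \<Gamma> then ?n ` c \<Gamma> else c \<Delta>) = 1"
      using single[of "\<lambda>\<Delta>. if \<Delta> = \<Gamma> then ?n ` c \<Gamma> else c \<Delta>"] c M_image_block[OF \<Gamma> c(1)[OF \<Gamma>] n]
      by simp
    then obtain x where "(\<Inter>\<Delta>\<in>E. if \<Delta> = \<Gamma> then ?n ` c \<Gamma> else c \<Delta>) = {x}"
      by (rule card_1_singletonE)
    then have x: "x \<in> (if \<Delta> = \<Gamma> then ?n ` c \<Gamma> else c \<Delta>)" if "\<Delta> \<in> E" for \<Delta>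
      using that by blast
    then have x1: "x \<in> ?n ` c \<Gamma>" and x2: "\<And>\<Delta>. \<Delta> \<in> E \<Longrightarrow> \<Delta> \<noteq> \<Gamma> \<Longrightarrow> x \<in> c \<Delta>"
      using \<Gamma> by (metis (full_types))+
    have "x \<in> \<Omega>" using x1 block_subset[OF \<Gamma> M_image_block[OF \<Gamma> c(1)[OF \<Gamma>] n]] by blast
    then obtain l where l: "l \<in> M" "l \<omega> = x"
      using M_transitive[OF \<omega>_in] by blast
    have "l \<in> S \<Delta>" if "\<Delta> \<in> E" "\<Delta> \<noteq> \<Gamma>" for \<Delta>
      using S_iff[OF l(1) that(1)] x2[OF that] l(2) by simp
    then have l': "inv\<^bsub>B\<^esub> l \<in> \<Inter>(S ` E - {S \<Gamma>})"
      using subgroup.m_inv_closed[OF sub] by blast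
    have "(m \<otimes>\<^bsub>B\<^esub> l) \<omega> = m x"
      using mult_apply[OF M_carrier[OF m] M_carrier[OF l(1)] \<omega>_in] l(2) by simp
    also have "\<dots> \<in> c \<Gamma>"
      using x1 image_inv[OF M_carrier[OF m] block_subset[OF \<Gamma> c(1)[OF \<Gamma>]]] by blast
    finally have "m \<otimes>\<^bsub>B\<^esub> l \<in> S \<Gamma>"
      using S_iff[OF M_mult[OF m l(1)] \<Gamma>] by simp
    moreover have "m = (m \<otimes>\<^bsub>B\<^esub> l) \<otimes>\<^bsub>B\<^esub> inv\<^bsub>B\<^esub> l"
      using m l M_carrier by (simp add: B.m_assoc)
    ultimately show "m \<in> S \<Gamma> <#>\<^bsub>B\<^esub> (\<Inter>(S ` E - {S \<Gamma>}))"
      using l' unfolding set_mult_def by blast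
  qed
  show ?thesis
    unfolding cartesian_system_def K
    using finE card2 card_image[OF inj] sub SM Inter factor by auto
qed

text \<open>Conjugating the stabiliser of \<gamma> by \<open>g\<close> gives the stabiliser of the
  image of \<gamma>. As \<open>g\<close> fixes \<omega>, that image is again a part through
  \<omega>, of a partition in \<open>E\<close>.\<close>

lemma conj_invariant_K_omega: "conj_invariant \<Omega> (stab G \<omega>) (K_omega M \<omega> E)"
  unfolding conj_invariant_def
proof (intro ballI)
  fix g K assume "g \<in> stab G \<omega>" and "K \<in> K_omega M \<omega> E"
  then obtain \<Gamma> \<gamma> where g: "g \<in> G" "g \<omega> = \<omega>"
    and \<gamma>: "\<Gamma> \<in> E" "\<gamma> \<in> \<Gamma>" "\<omega> \<in> \<gamma>" and K: "K = set_stab M \<gamma>"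
    by (auto simp: K_omega_def stab_def)
  have gB: "g \<in> carrier B" "inv\<^bsub>B\<^esub> g \<in> carrier B" using g G_carrier by auto
  have sub: "\<gamma> \<subseteq> \<Omega>" using block_subset \<gamma> by blast
  have "(\<lambda>k. g \<otimes>\<^bsub>B\<^esub> k \<otimes>\<^bsub>B\<^esub> inv\<^bsub>B\<^esub> g) ` K = set_stab M (g ` \<gamma>)"
  proof (intro equalityI subsetI)
    fix x assume "x \<in> (\<lambda>k. g \<otimes>\<^bsub>B\<^esub> k \<otimes>\<^bsub>B\<^esub> inv\<^bsub>B\<^esub> g) ` K"
    then obtain k where k: "k \<in> M" "k ` \<gamma> = \<gamma>" "x = g \<otimes>\<^bsub>B\<^esub> k \<otimes>\<^bsub>B\<^esub> inv\<^bsub>B\<^esub> g"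
      by (auto simp: K set_stab_def)
    then have "x ` g ` \<gamma> = g ` \<gamma>"
      using gB M_carrier[OF k(1)] sub image_in[OF gB(1) sub]
      by (simp add: mult_image inv_image)
    then show "x \<in> set_stab M (g ` \<gamma>)"
      using k conj_M[OF g(1)] by (simp add: set_stab_def)
  next
    fix x assume x: "x \<in> set_stab M (g ` \<gamma>)"
    then have xM: "x \<in> M" and xg: "x ` g ` \<gamma> = g ` \<gamma>" by (auto simp: set_stab_def)
    have xB: "x \<in> carrier B" using M_carrier xM by blast
    let ?k = "inv\<^bsub>B\<^esub> g \<otimes>\<^bsub>B\<^esub> x \<otimes>\<^bsub>B\<^esub> g"
    have "?k ` \<gamma> = \<gamma>"
      using gB xB sub image_in[OF gB(1) sub] xg by (simp add: mult_image inv_image)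
    then have "?k \<in> K" using conj_M'[OF g(1) xM] by (simp add: K set_stab_def)
    moreover have "x = g \<otimes>\<^bsub>B\<^esub> ?k \<otimes>\<^bsub>B\<^esub> inv\<^bsub>B\<^esub> g"
      using mult_conj_inv[OF gB(1) xB] by simp
    ultimately show "x \<in> (\<lambda>k. g \<otimes>\<^bsub>B\<^esub> k \<otimes>\<^bsub>B\<^esub> inv\<^bsub>B\<^esub> g) ` K" by blast
  qed
  moreover have "map_partition g \<Gamma> \<in> E"
    using E g(1) \<gamma>(1) by (simp add: CD_def G_invariant_CD_def)
  moreover have "\<omega> \<in> g ` \<gamma>" using g(2) \<gamma>(3) by force
  ultimately show "(\<lambda>k. g \<otimes>\<^bsub>B\<^esub> k \<otimes>\<^bsub>B\<^esub> inv\<^bsub>B\<^esub> g) ` K \<in> K_omega M \<omega> E"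
    using \<gamma>(2) unfolding K_omega_def by blast
qed

end

section \<open>From an invariant Cartesian system to a Cartesian decomposition\<close>

context
  fixes \<K>
  assumes system: "cartesian_system \<Omega> M \<omega> \<K>"
    and conj_inv: "conj_invariant \<Omega> (stab G \<omega>) \<K>"
begin

lemma K_subgroup: "K \<in> \<K> \<Longrightarrow> subgroup K B"
  and K_le_M: "K \<in> \<K> \<Longrightarrow> K \<subseteq> M"
  and Inter_\<K>: "\<Inter>\<K> = stab M \<omega>"
  and K_factor: "K \<in> \<K> \<Longrightarrow> K <#>\<^bsub>B\<^esub> \<Inter>(\<K> - {K}) = M"
  and finite_\<K>: "finite \<K>"
  and card_\<K>: "card \<K> \<ge> 2"
  using system by (simp_all add: cartesian_system_def)

lemma K_carrier: "K \<in> \<K> \<Longrightarrow> k \<in> K \<Longrightarrow> k \<in> carrier B"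
  using K_le_M M_carrier by blast

text \<open>Every member \<open>K\<close> contains the stabiliser of \<omega>, because the
  intersection of the system does. Hence two elements of \<open>M\<close> that agree at \<omega> lie
  in \<open>K\<close> together or not at all.\<close>

lemma mem_block_iff:
  assumes K: "K \<in> \<K>" and m: "m \<in> M"
  shows "m \<omega> \<in> block K \<longleftrightarrow> m \<in> K"
proof
  assume "m \<omega> \<in> block K"
  then obtain k where k: "k \<in> K" "m \<omega> = k \<omega>" by (auto simp: block_def)
  have kM: "k \<in> M" using k K_le_M[OF K] by blast
  have "(inv\<^bsub>B\<^esub> k \<otimes>\<^bsub>B\<^esub> m) \<omega> = \<omega>"
    using k(2) M_carrier[OF kM] M_carrier[OF m] \<omega>_in by (simp add: mult_apply inv_apply)
  then have "inv\<^bsub>B\<^esub> k \<otimes>\<^bsub>B\<^esub> m \<in> stab M \<omega>"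
    using M_mult[OF M_inv[OF kM] m] by (simp add: stab_def)
  then have "inv\<^bsub>B\<^esub> k \<otimes>\<^bsub>B\<^esub> m \<in> K" using Inter_\<K> K by blast
  then have "k \<otimes>\<^bsub>B\<^esub> (inv\<^bsub>B\<^esub> k \<otimes>\<^bsub>B\<^esub> m) \<in> K"
    using subgroup.m_closed[OF K_subgroup[OF K]] k by blast
  then show "m \<in> K"
    using M_carrier[OF kM] M_carrier[OF m] by (simp add: B.m_assoc[symmetric])
qed (auto simp: block_def)

lemma block_sub: "K \<in> \<K> \<Longrightarrow> block K \<subseteq> \<Omega>"
  using K_carrier apply_in \<omega>_in by (auto simp: block_def)

text \<open>The dictionary between blocks and left cosets: the translate of the block by
  \<open>m\<close> corresponds to the coset \<open>m K\<close>.\<close>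

lemma mem_image_block_iff:
  assumes K: "K \<in> \<K>" and m: "m \<in> M" and n: "n \<in> M"
  shows "n \<omega> \<in> m ` block K \<longleftrightarrow> inv\<^bsub>B\<^esub> m \<otimes>\<^bsub>B\<^esub> n \<in> K"
proof -
  have nB: "n \<in> carrier B" and mB: "m \<in> carrier B" using m n M_carrier by auto
  have eq: "(inv\<^bsub>B\<^esub> m \<otimes>\<^bsub>B\<^esub> n) \<omega> = (inv\<^bsub>B\<^esub> m) (n \<omega>)"
    using nB mB \<omega>_in by (simp add: mult_apply)
  have "n \<omega> \<in> m ` block K \<longleftrightarrow> (inv\<^bsub>B\<^esub> m) (n \<omega>) \<in> block K"
  proof
    assume "n \<omega> \<in> m ` block K"
    then have "(inv\<^bsub>B\<^esub> m) (n \<omega>) \<in> (inv\<^bsub>B\<^esub> m) ` m ` block K" by blast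
    then show "(inv\<^bsub>B\<^esub> m) (n \<omega>) \<in> block K"
      unfolding inv_image[OF mB block_sub[OF K]] .
  next
    assume "(inv\<^bsub>B\<^esub> m) (n \<omega>) \<in> block K"
    then show "n \<omega> \<in> m ` block K"
      using apply_inv[OF mB apply_in[OF nB \<omega>_in]] by (metis imageI)
  qed
  then show ?thesis
    using mem_block_iff[OF K M_mult[OF M_inv[OF m] n]] eq by simp
qed

text \<open>An element \<open>l\<close> taking \<omega> into the translate lies in the coset
  \<open>m K\<close>, so it differs from \<open>m\<close> by a factor in \<open>K\<close>, and
  \<open>K\<close> preserves its own orbit. A translate is thus determined by any of its
  points.\<close>

lemma image_block_cong:
  assumes K: "K \<in> \<K>" and m: "m \<in> M" and x: "x \<in> m ` block K" and l: "l \<in> M" "x = l \<omega>"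
  shows "l ` block K = m ` block K"
proof -
  have B: "m \<in> carrier B" "l \<in> carrier B" using m l M_carrier by auto
  let ?k = "inv\<^bsub>B\<^esub> m \<otimes>\<^bsub>B\<^esub> l"
  have kK: "?k \<in> K" using mem_image_block_iff[OF K m l(1)] x l(2) by simp
  have "(\<lambda>x. ?k \<otimes>\<^bsub>B\<^esub> x) ` K = K"
    using B.coset_join3[OF _ K_subgroup[OF K] kK] K_carrier[OF K kK] by (auto simp: l_coset_def)
  moreover have "?k ` block K = block ((\<lambda>x. ?k \<otimes>\<^bsub>B\<^esub> x) ` K)"
    unfolding block_def image_image
    using mult_apply[OF K_carrier[OF K kK] K_carrier[OF K] \<omega>_in] by (intro image_cong refl) simp
  ultimately have "m ` ?k ` block K = m ` block K" by simp
  moreover have "m ` ?k ` block K = (m \<otimes>\<^bsub>B\<^esub> ?k) ` block K"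
    using mult_image[OF B(1) K_carrier[OF K kK] block_sub[OF K]] by simp
  moreover have "m \<otimes>\<^bsub>B\<^esub> ?k = l" using B by (simp add: B.m_assoc[symmetric])
  ultimately show ?thesis by simp
qed

lemma \<omega>_in_block: "K \<in> \<K> \<Longrightarrow> \<omega> \<in> block K"
  using subgroup.one_closed[OF K_subgroup] one_apply[OF \<omega>_in] unfolding block_def
  by (metis imageI)

lemma partition_block_system:
  assumes K: "K \<in> \<K>"
  shows "partition_on \<Omega> (block_system K)"
proof (rule partition_onI)
  show "\<Union>(block_system K) = \<Omega>"
  proof (intro equalityI subsetI)
    fix x assume "x \<in> \<Union>(block_system K)"
    then show "x \<in> \<Omega>" using image_in[OF M_carrier block_sub[OF K]] unfolding block_system_def by blast
  next
    fix x assume "x \<in> \<Omega>"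
    then obtain m where "m \<in> M" "m \<omega> = x" using M_transitive[OF \<omega>_in] by blast
    then show "x \<in> \<Union>(block_system K)" using \<omega>_in_block[OF K] unfolding block_system_def by blast
  qed
next
  fix p q assume p: "p \<in> block_system K" and q: "q \<in> block_system K" and ne: "p \<noteq> q"
  obtain m n where m: "m \<in> M" "p = m ` block K" and n: "n \<in> M" "q = n ` block K"
    using p q by (auto simp: block_system_def)
  show "disjnt p q"
  \<comment> \<open>Two translates with a common point both equal the translate by any
    \<open>l\<close> taking \<omega> to that point.\<close>
  proof (rule ccontr)
    assume "\<not> disjnt p q"
    then obtain x where x: "x \<in> p" "x \<in> q" by (auto simp: disjnt_def)
    then have "x \<in> \<Omega>" using image_in[OF M_carrier[OF m(1)] block_sub[OF K]] m by blast
    then obtain l where l: "l \<in> M" "x = l \<omega>" using M_transitive[OF \<omega>_in] by blast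
    have "l ` block K = p"
      using image_block_cong[OF K m(1) _ l] x(1) m(2) by simp
    moreover have "l ` block K = q"
      using image_block_cong[OF K n(1) _ l] x(2) n(2) by simp
    ultimately show False using ne by simp
  qed
next
  show "{} \<notin> block_system K"
    using \<omega>_in_block[OF K] by (auto simp: block_system_def)
qed

lemma block_system_block_eq:
  assumes K: "K \<in> \<K>" and "\<gamma> \<in> block_system K" "\<omega> \<in> \<gamma>"
  shows "\<gamma> = block K"
proof -
  obtain m where m: "m \<in> M" "\<gamma> = m ` block K" using assms by (auto simp: block_system_def)
  have "\<one>\<^bsub>B\<^esub> ` block K = m ` block K"
    using image_block_cong[OF K m(1) _ M_one] assms(3) m(2) one_apply[OF \<omega>_in] by simp
  then show ?thesis using one_image[OF block_sub[OF K]] m(2) by simp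
qed

lemma block_in_block_system: "K \<in> \<K> \<Longrightarrow> block K \<in> block_system K"
  using M_one one_image[OF block_sub, of K] unfolding block_system_def by force

text \<open>Stabilising the block forces \<omega> to be sent into it, which already characterises
  \<open>K\<close> within \<open>M\<close>.\<close>

lemma set_stab_block:
  assumes K: "K \<in> \<K>"
  shows "set_stab M (block K) = K"
proof (intro equalityI subsetI)
  fix m assume "m \<in> set_stab M (block K)"
  then show "m \<in> K"
    using \<omega>_in_block[OF K] mem_block_iff[OF K, of m] by (auto simp: set_stab_def)
next
  fix k assume k: "k \<in> K"
  then have "k \<in> M" using K_le_M[OF K] by blast
  moreover from this have "k ` block K = block K"
    using image_block_cong[OF K M_one, of "k \<omega>" k] one_image[OF block_sub[OF K]] k
    by (simp add: block_def)
  ultimately show "k \<in> set_stab M (block K)" by (simp add: set_stab_def)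
qed

text \<open>The part through \<omega> is \<open>block K\<close>, and its stabiliser in
  \<open>M\<close> recovers \<open>K\<close>.\<close>

lemma inj_block_system: "inj_on block_system \<K>"
proof (rule inj_onI)
  fix K L assume K: "K \<in> \<K>" and L: "L \<in> \<K>" and eq: "block_system K = block_system L"
  have "block K = block L"
    using block_system_block_eq[OF L] block_in_block_system[OF K] \<omega>_in_block[OF K] eq by simp
  then show "K = L" using set_stab_block[OF K] set_stab_block[OF L] by metis
qed

lemma K_omega_block_system: "K_omega M \<omega> (block_system ` \<K>) = \<K>"
proof (intro equalityI subsetI)
  fix K assume "K \<in> K_omega M \<omega> (block_system ` \<K>)"
  then obtain L \<gamma> where "L \<in> \<K>" "\<gamma> \<in> block_system L" "\<omega> \<in> \<gamma>" "K = set_stab M \<gamma>"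
    by (auto simp: K_omega_def)
  then show "K \<in> \<K>" using block_system_block_eq set_stab_block by metis
next
  fix K assume K: "K \<in> \<K>"
  then show "K \<in> K_omega M \<omega> (block_system ` \<K>)"
    using block_in_block_system[OF K] \<omega>_in_block[OF K] set_stab_block[OF K]
    unfolding K_omega_def by blast
qed

text \<open>An argument in the style of the Chinese remainder theorem. Given \<open>m\<close> in the
  cosets for \<open>S\<close>, the factorisation for the new member \<open>L\<close> writes
  \<open>inv (c L) m\<close> as \<open>k l\<close> with \<open>k\<close> in \<open>L\<close> and
  \<open>l\<close> in all other members. Multiplying \<open>m\<close> on the right by the inverse of
  \<open>l\<close> keeps it in the old cosets and puts it into the coset for
  \<open>L\<close>.\<close>

lemma cosets_intersect:
  assumes "S \<subseteq> \<K>" "\<And>K. K \<in> S \<Longrightarrow> c K \<in> M"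
  shows "\<exists>m\<in>M. \<forall>K\<in>S. inv\<^bsub>B\<^esub> (c K) \<otimes>\<^bsub>B\<^esub> m \<in> K"
proof -
  have "finite S" using assms(1) finite_\<K> finite_subset by blast
  then show ?thesis using assms
  proof (induction S rule: finite_induct)
    case empty
    show ?case using M_one by blast
  next
    case (insert L S)
    then obtain m where m: "m \<in> M" "\<And>K. K \<in> S \<Longrightarrow> inv\<^bsub>B\<^esub> (c K) \<otimes>\<^bsub>B\<^esub> m \<in> K" by auto
    have L: "L \<in> \<K>" "c L \<in> M" using insert.prems by auto
    have "inv\<^bsub>B\<^esub> (c L) \<otimes>\<^bsub>B\<^esub> m \<in> L <#>\<^bsub>B\<^esub> \<Inter>(\<K> - {L})"
      using M_mult[OF M_inv[OF L(2)] m(1)] K_factor[OF L(1)] by simp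
    then obtain k l where k: "k \<in> L" and l: "l \<in> \<Inter>(\<K> - {L})"
      and kl: "inv\<^bsub>B\<^esub> (c L) \<otimes>\<^bsub>B\<^esub> m = k \<otimes>\<^bsub>B\<^esub> l"
      unfolding set_mult_def by blast
    \<comment> \<open>Needed for \<open>l\<close> to lie in \<open>M\<close>: the intersection of no
      sets is \<open>UNIV\<close>.\<close>
    have "\<K> - {L} \<noteq> {}"
    proof
      assume "\<K> - {L} = {}"
      then have "\<K> \<subseteq> {L}" by blast
      then have "card \<K> \<le> 1" using card_mono[of "{L}"] by simp
      then show False using card_\<K> by simp
    qed
    then have lM: "l \<in> M" using l K_le_M by blast
    have B: "c L \<in> carrier B" "m \<in> carrier B" "k \<in> carrier B" "l \<in> carrier B"
      using L m lM M_carrier K_carrier k by auto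
    show ?case
    proof (intro bexI ballI)
      show "m \<otimes>\<^bsub>B\<^esub> inv\<^bsub>B\<^esub> l \<in> M" using m lM M_mult M_inv by blast
      fix K assume K: "K \<in> insert L S"
      show "inv\<^bsub>B\<^esub> (c K) \<otimes>\<^bsub>B\<^esub> (m \<otimes>\<^bsub>B\<^esub> inv\<^bsub>B\<^esub> l) \<in> K"
      proof (cases "K = L")
        case True
        have "inv\<^bsub>B\<^esub> (c L) \<otimes>\<^bsub>B\<^esub> (m \<otimes>\<^bsub>B\<^esub> inv\<^bsub>B\<^esub> l) = (k \<otimes>\<^bsub>B\<^esub> l) \<otimes>\<^bsub>B\<^esub> inv\<^bsub>B\<^esub> l"
          using B by (simp add: B.m_assoc[symmetric] kl)
        also have "\<dots> = k" using B by (simp add: B.m_assoc)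
        finally show ?thesis using k True by simp
      next
        case False
        then have "K \<in> S" "K \<in> \<K>" using K insert.prems by auto
        then have "inv\<^bsub>B\<^esub> (c K) \<otimes>\<^bsub>B\<^esub> m \<in> K" "inv\<^bsub>B\<^esub> l \<in> K" "c K \<in> carrier B"
          using m(2) l False subgroup.m_inv_closed[OF K_subgroup] insert.prems M_carrier by auto
        then show ?thesis
          using subgroup.m_closed[OF K_subgroup[OF \<open>K \<in> \<K>\<close>]] B by (simp add: B.m_assoc[symmetric])
      qed
    qed
  qed
qed

text \<open>Chosen parts correspond to cosets of the members of the system. A common element of
  these cosets gives a common point, and it is unique because the members intersect in the
  stabiliser of \<omega>.\<close>

lemma decomposition_block_system: "cartesian_decomposition \<Omega> (block_system ` \<K>)"
  unfolding cartesian_decomposition_def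
proof (intro conjI ballI allI impI)
  show "finite (block_system ` \<K>)" using finite_\<K> by simp
  show "2 \<le> card (block_system ` \<K>)" using card_\<K> card_image[OF inj_block_system] by simp
  show "partition_on \<Omega> \<Gamma>" if "\<Gamma> \<in> block_system ` \<K>" for \<Gamma>
    using that partition_block_system by blast
next
  fix f assume f: "\<forall>\<Gamma>\<in>block_system ` \<K>. f \<Gamma> \<in> \<Gamma>"
  then have "\<forall>K\<in>\<K>. \<exists>m. m \<in> M \<and> f (block_system K) = m ` block K"
    by (auto simp: block_system_def)
  then obtain c where c: "\<And>K. K \<in> \<K> \<Longrightarrow> c K \<in> M"
    "\<And>K. K \<in> \<K> \<Longrightarrow> f (block_system K) = c K ` block K" by metis
  obtain m where m: "m \<in> M" "\<And>K. K \<in> \<K> \<Longrightarrow> inv\<^bsub>B\<^esub> (c K) \<otimes>\<^bsub>B\<^esub> m \<in> K"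
    using cosets_intersect[of \<K> c] c by blast
  have mB: "m \<in> carrier B" using m M_carrier by blast
  \<comment> \<open>All chosen parts become translates by the same \<open>m\<close>, which reduces
    the claim to the fact that the blocks through \<omega> meet only in \<omega>.\<close>
  have f_eq: "f (block_system K) = m ` block K" if K: "K \<in> \<K>" for K
    using image_block_cong[OF K c(1)[OF K] _ m(1)] mem_image_block_iff[OF K c(1)[OF K] m(1)]
      m(2)[OF K] c(2)[OF K] by simp
  have "(\<Inter>\<Gamma>\<in>block_system ` \<K>. f \<Gamma>) = {m \<omega>}"
  proof (intro equalityI subsetI)
    fix x assume "x \<in> (\<Inter>\<Gamma>\<in>block_system ` \<K>. f \<Gamma>)"
    then have x: "\<And>K. K \<in> \<K> \<Longrightarrow> x \<in> m ` block K" using f_eq by auto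
    obtain K where "K \<in> \<K>" using card_\<K> by fastforce
    then have "x \<in> \<Omega>" using x image_in[OF mB block_sub] by blast
    then obtain l where l: "l \<in> M" "x = l \<omega>" using M_transitive[OF \<omega>_in] by blast
    then have "inv\<^bsub>B\<^esub> m \<otimes>\<^bsub>B\<^esub> l \<in> \<Inter>\<K>"
      using x mem_image_block_iff[OF _ m(1)] by blast
    then have "(inv\<^bsub>B\<^esub> m \<otimes>\<^bsub>B\<^esub> l) \<omega> = \<omega>" unfolding Inter_\<K> by (simp add: stab_def)
    then have "(inv\<^bsub>B\<^esub> m) x = \<omega>"
      using mB l M_carrier \<omega>_in by (simp add: mult_apply)
    then show "x \<in> {m \<omega>}" using apply_inv[OF mB \<open>x \<in> \<Omega>\<close>] by simp
  next
    fix x assume "x \<in> {m \<omega>}"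
    then show "x \<in> (\<Inter>\<Gamma>\<in>block_system ` \<K>. f \<Gamma>)" using f_eq \<omega>_in_block by auto
  qed
  then show "card (\<Inter>\<Gamma>\<in>block_system ` \<K>. f \<Gamma>) = 1" by simp
qed

lemma M_fixes_block_system:
  assumes K: "K \<in> \<K>" and m: "m \<in> M"
  shows "map_partition m (block_system K) = block_system K"
proof -
  have "map_partition m (block_system K) = (\<lambda>n. n ` block K) ` (\<lambda>n. m \<otimes>\<^bsub>B\<^esub> n) ` M"
    unfolding block_system_def image_image[of _ _ M]
    using mult_image[OF M_carrier[OF m] M_carrier block_sub[OF K]]
    by (intro image_cong[OF refl, of M]) simp
  also have "(\<lambda>n. m \<otimes>\<^bsub>B\<^esub> n) ` M = M"
    using B.coset_join3[OF M_carrier[OF m] subgroup_M m] by (auto simp: l_coset_def)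
  finally show ?thesis by (simp add: block_system_def)
qed

text \<open>Since \<open>g\<close> fixes \<omega>, it carries the orbit of \<omega> under
  \<open>K\<close> to the orbit under the conjugate of \<open>K\<close>; since it normalises
  \<open>M\<close>, it carries translates to translates.\<close>

lemma stab_image_block_system:
  assumes K: "K \<in> \<K>" and g: "g \<in> G" "g \<omega> = \<omega>"
  shows "map_partition g (block_system K) = block_system (conj_set g K)"
proof -
  have gB: "g \<in> carrier B" using g G_carrier by blast
  have conj_image: "(g \<otimes>\<^bsub>B\<^esub> m \<otimes>\<^bsub>B\<^esub> inv\<^bsub>B\<^esub> g) ` g ` \<gamma> = g ` m ` \<gamma>"
    if "m \<in> M" "\<gamma> \<subseteq> \<Omega>" for m \<gamma>
    using gB M_carrier[OF that(1)] that(2) image_in[OF gB that(2)]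
    by (simp add: mult_image inv_image)
  have inv\<omega>: "(inv\<^bsub>B\<^esub> g) \<omega> = \<omega>" using inv_apply[OF gB \<omega>_in] g(2) by simp
  have block: "block (conj_set g K) = g ` block K"
    unfolding block_def conj_set_def image_image
  proof (intro image_cong refl)
    fix k assume "k \<in> K"
    then show "(g \<otimes>\<^bsub>B\<^esub> k \<otimes>\<^bsub>B\<^esub> inv\<^bsub>B\<^esub> g) \<omega> = g (k \<omega>)"
      using gB K_carrier[OF K] \<omega>_in inv\<omega> by (simp add: mult_apply)
  qed
  have conjM: "conj_set g M = M"
  proof (intro equalityI subsetI)
    fix m assume "m \<in> conj_set g M"
    then show "m \<in> M" using conj_M[OF g(1)] by (auto simp: conj_set_def)
  next
    fix m assume m: "m \<in> M"
    have "m = g \<otimes>\<^bsub>B\<^esub> (inv\<^bsub>B\<^esub> g \<otimes>\<^bsub>B\<^esub> m \<otimes>\<^bsub>B\<^esub> g) \<otimes>\<^bsub>B\<^esub> inv\<^bsub>B\<^esub> g"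
      using mult_conj_inv[OF gB M_carrier[OF m]] by simp
    then show "m \<in> conj_set g M" using conj_M'[OF g(1) m] unfolding conj_set_def by blast
  qed
  have "block_system (conj_set g K) = (\<lambda>m. m ` g ` block K) ` conj_set g M"
    unfolding block_system_def block conjM ..
  also have "\<dots> = map_partition g (block_system K)"
    unfolding conj_set_def block_system_def image_image[of _ _ M]
    using conj_image[OF _ block_sub[OF K]] by (intro image_cong[OF refl, of M]) simp
  finally show ?thesis by simp
qed

text \<open>A Frattini argument: by transitivity of \<open>M\<close>, each \<open>g\<close> in
  \<open>G\<close> is a product of some \<open>m\<close> in \<open>M\<close> and some
  \<open>h\<close> fixing \<omega>. Here \<open>h\<close> permutes the block systems by conjugation
  invariance, and \<open>m\<close> fixes each of them.\<close>

lemma block_system_in_CD: "block_system ` \<K> \<in> CD \<Omega> G"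
proof -
  have "map_partition g (block_system K) \<in> block_system ` \<K>" if g: "g \<in> G" and K: "K \<in> \<K>" for g K
  proof -
    have gB: "g \<in> carrier B" using g G_carrier by blast
    obtain m where m: "m \<in> M" "m \<omega> = g \<omega>"
      using M_transitive[OF \<omega>_in apply_in[OF gB \<omega>_in]] by blast
    let ?h = "inv\<^bsub>B\<^esub> m \<otimes>\<^bsub>B\<^esub> g"
    have mB: "m \<in> carrier B" using m M_carrier by blast
    have h: "?h \<in> G" "?h \<omega> = \<omega>"
      using subgroup.m_closed[OF subgroup_G] g m M_inv M_le_G gB mB \<omega>_in inv_apply[OF mB \<omega>_in]
      by (auto simp: mult_apply)
    have hB: "?h \<in> carrier B" using h G_carrier by blast
    have "conj_set ?h K \<in> \<K>"
      using conj_inv h K unfolding conj_invariant_def conj_set_def by (simp add: stab_def)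
    moreover have "map_partition g (block_system K) = map_partition m (map_partition ?h (block_system K))"
    proof -
      have "block_system K \<subseteq> Pow \<Omega>" using partition_onD1[OF partition_block_system[OF K]] by blast
      moreover have "m \<otimes>\<^bsub>B\<^esub> ?h = g" using mB gB by (simp add: B.m_assoc[symmetric])
      ultimately show ?thesis using mult_map_partition[OF mB hB] by metis
    qed
    ultimately show ?thesis
      using stab_image_block_system[OF K h] M_fixes_block_system[OF _ m(1)] by simp
  qed
  then show ?thesis
    using decomposition_block_system by (auto simp: CD_def G_invariant_CD_def)
qed

end

end

theorem theorem4p2:
  fixes \<Omega> :: "'a set" and G M :: "('a \<Rightarrow> 'a) set" and \<omega> :: 'a
  assumes "finite \<Omega>"
    and "innately_transitive \<Omega> G"
    and "plinth \<Omega> G M"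
    and "\<omega> \<in> \<Omega>"
  shows "bij_betw (K_omega M \<omega>) (CD \<Omega> G)
           {\<K>. cartesian_system \<Omega> M \<omega> \<K> \<and> conj_invariant \<Omega> (stab G \<omega>) \<K>}"
proof -
  interpret plinth_setting \<Omega> G M \<omega>
    using assms
    by (intro plinth_setting.intro) (auto simp: innately_transitive_def perm_group_def plinth_def)
  show ?thesis
  \<comment> \<open>Taking stabilisers and forming block systems undo each other, and each
    construction lands in the required set.\<close>
  proof (rule bij_betw_byWitness[where f' = "\<lambda>\<K>. block_system ` \<K>"])
    show "\<forall>E\<in>CD \<Omega> G. block_system ` K_omega M \<omega> E = E"
      using image_block_system_K_omega by blast
  qed (use K_omega_block_system cartesian_system_K_omega conj_invariant_K_omega
      block_system_in_CD in auto)
qed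

end
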